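(* Let $n\ge 2$ be an integer, let $D_a>0$, $L>0$, and let $\alpha\in\mathbb{R}$ be such that $\alpha_f^{(n)}<-\alpha<0$. Then the optimization problem $\mathbf{S}_\alpha^{(n)}$: minimize $\kappa^2$ over all $\kappa\in\mathbb{R}$ such that (i) $A_\kappa^{(n)}$ is a Metzler matrix and (ii) $A_\kappa^{(n)}$ is $\beta$-exponentially stable for all $\beta\in(-\alpha,0]$, has a unique solution $\kappa_*^{(n)}$, which is given by $$\kappa_*^{(n)}=\frac{1}{\sqrt{D_a}}\cdot\frac{\displaystyle\sum_{l=0}^{n-1}\binom{n+l}{2l+1}\frac{(-\alpha)^{l+1}}{p_2^{\,l+\frac12}}}{\displaystyle\sum_{l=0}^{n-1}\binom{n+l-1}{2l}\frac{(-\alpha)^{l}}{p_2^{\,l}}}.$$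
   Context: Let $\Delta z=L/(n-1)$, $p_1=D_a(\Delta z)^{-1}$, $p_2=D_a(\Delta z)^{-2}$. $A^{(n)}\in\mathbb{R}^{n\times n}$ is the symmetric tridiagonal matrix whose sub- and super-diagonal entries all equal $p_2$, whose first and last diagonal entries equal $-p_2$, and whose other diagonal entries equal $-2p_2$. For $\kappa\in\mathbb{R}$, $A_\kappa^{(n)}:=A^{(n)}+\kappa p_1\mathbf{e}_1\mathbf{e}_1^\top$, with $\mathbf{e}_1$ the first canonical basis vector of $\mathbb{R}^n$. For $M\in\mathbb{R}^{n\times n}$ and $1\le j\le n$, $[M]_{|j}$ denotes the determinant of the $j\times j$ submatrix of $M$ formed by its last $j$ rows and columns. Set $\alpha_f^{(n)}:=\max\{\lambda\in\mathbb{R}:[A^{(n)}-\lambda I]_{|n-1}=0\}$. A real square matrix is Metzler if its off-diagonal entries are nonnegative. A matrix is $\beta$-exponentially stable if all its eigenvalues have real part less than $\beta$; thus condition (ii) is equivalent to $\max\{\lambda:\lambda\in\sigma(A_\kappa^{(n)})\}\le-\alpha$ (the eigenvalues of $A_\kappa^{(n)}$ are real). *)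

theory Defs
  imports
    Complex_Main
    "Jordan_Normal_Form.Char_Poly"
    "Jordan_Normal_Form.DL_Submatrix"
begin

(* Conventions: indices of matrices and vectors start at 0, so the first canonical
   basis vector is unit_vec n 0. D stands for D_a and Delta z = dz L n. *)

definition dz :: "real \<Rightarrow> nat \<Rightarrow> real" where
  "dz L n = L / (real n - 1)"

definition p1 :: "real \<Rightarrow> real \<Rightarrow> nat \<Rightarrow> real" where
  "p1 D L n = D * inverse (dz L n)"

definition p2 :: "real \<Rightarrow> real \<Rightarrow> nat \<Rightarrow> real" where
  "p2 D L n = D * inverse ((dz L n)\<^sup>2)"

definition A_mat :: "real \<Rightarrow> real \<Rightarrow> nat \<Rightarrow> real mat" where
  "A_mat D L n = mat n n (\<lambda>(i, j).
     if i = j then (if i = 0 \<or> i = n - 1 then - p2 D L n else - 2 * p2 D L n)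
     else if i = j + 1 \<or> j = i + 1 then p2 D L n
     else 0)"

definition A_kappa :: "real \<Rightarrow> real \<Rightarrow> nat \<Rightarrow> real \<Rightarrow> real mat" where
  "A_kappa D L n \<kappa> = A_mat D L n +
     (\<kappa> * p1 D L n) \<cdot>\<^sub>m (mat_of_cols n [unit_vec n 0] * mat_of_row (unit_vec n 0))"

(* Meant for square M and j \<le> dim_row M. *)
definition trailing_minor :: "real mat \<Rightarrow> nat \<Rightarrow> real" where
  "trailing_minor M j =
     det (submatrix M {dim_row M - j..<dim_row M} {dim_col M - j..<dim_col M})"

(* For n \<ge> 2 and D, L > 0 the set is finite and nonempty (its elements are the
   eigenvalues of a real symmetric matrix), so Max is its genuine maximum. *)
definition alpha_f :: "real \<Rightarrow> real \<Rightarrow> nat \<Rightarrow> real" where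
  "alpha_f D L n = Max {x. trailing_minor (A_mat D L n - x \<cdot>\<^sub>m 1\<^sub>m n) (n - 1) = 0}"

definition metzler :: "real mat \<Rightarrow> bool" where
  "metzler M \<longleftrightarrow> square_mat M \<and>
     (\<forall>i < dim_row M. \<forall>j < dim_col M. i \<noteq> j \<longrightarrow> 0 \<le> M $$ (i, j))"

definition exp_stable :: "real \<Rightarrow> real mat \<Rightarrow> bool" where
  "exp_stable \<beta> M \<longleftrightarrow>
     (\<forall>z. eigenvalue (map_mat complex_of_real M) z \<longrightarrow> Re z < \<beta>)"

definition feasible :: "real \<Rightarrow> real \<Rightarrow> nat \<Rightarrow> real \<Rightarrow> real \<Rightarrow> bool" where
  "feasible D L n \<alpha> \<kappa> \<longleftrightarrow> metzler (A_kappa D L n \<kappa>) \<and>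
     (\<forall>\<beta>. - \<alpha> < \<beta> \<and> \<beta> \<le> 0 \<longrightarrow> exp_stable \<beta> (A_kappa D L n \<kappa>))"

definition is_solution :: "real \<Rightarrow> real \<Rightarrow> nat \<Rightarrow> real \<Rightarrow> real \<Rightarrow> bool" where
  "is_solution D L n \<alpha> \<kappa> \<longleftrightarrow> is_arg_min (\<lambda>\<kappa>. \<kappa>\<^sup>2) (feasible D L n \<alpha>) \<kappa>"

definition kappa_star :: "real \<Rightarrow> real \<Rightarrow> nat \<Rightarrow> real \<Rightarrow> real" where
  "kappa_star D L n \<alpha> = 1 / sqrt D *
     ((\<Sum>l = 0..n - 1. real ((n + l) choose (2 * l + 1)) *
          ((- \<alpha>) ^ (l + 1) / p2 D L n powr (real l + 1 / 2))) /
      (\<Sum>l = 0..n - 1. real ((n + l - 1) choose (2 * l)) *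
          ((- \<alpha>) ^ l / p2 D L n ^ l)))"

end

theory Submission
  imports Defs
begin

text \<open>
  Read from the last row upwards, the eigenvector equation of A_kappa for the eigenvalue p2 * y is
  a three-term recurrence, so the eigenvector has entries w j = dir_poly (n - 1 - j) at y, and the
  first row becomes p2 * (dp n y - dp (n - 1) y) = kappa * p1 * dp (n - 1) y; moreover the zeros of
  dp (n - 1) give those of the trailing minor.  Hence at y = - alpha / p2, which lies to the right
  of all these zeros, the vector w is positive.  If kappa is at most kappa_star, then
  A_kappa w is at most - alpha w entrywise, and since A_kappa is Metzler its eigenvalues have real
  part at most - alpha.  If kappa exceeds kappa_star, the intermediate value theorem gives an
  eigenvalue above - alpha.  So the feasible set is the half-line up to kappa_star, and it omits 0
  because the constant vectors are in the kernel of A.\<close>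

section \<open>Polynomials of the three-term recurrence\<close>

text \<open>For k < n this is the characteristic polynomial of the trailing k by k block of
  \<open>A_mat\<close> divided by p2, with a Dirichlet condition at the cut: the Chebyshev
  polynomial of the third kind at 1 + y/2.\<close>

fun dir_poly :: "nat \<Rightarrow> real poly" where
  "dir_poly 0 = 1"
| "dir_poly (Suc 0) = [:1, 1:]"
| "dir_poly (Suc (Suc k)) = [:2, 1:] * dir_poly (Suc k) - dir_poly k"

abbreviation dp :: "nat \<Rightarrow> real \<Rightarrow> real" where
  "dp k y \<equiv> poly (dir_poly k) y"

lemma dp_Suc_Suc: "dp (Suc (Suc k)) y = (2 + y) * dp (Suc k) y - dp k y"
  by (simp add: algebra_simps)

text \<open>The increment of dp grows by y * \<open>dp (Suc k) y\<close> at each step. The bound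
  provides the right end point in intermediate value arguments.\<close>

lemma dp_mono_ge_1:
  assumes "0 \<le> y"
  shows "1 \<le> dp k y \<and> dp k y \<le> dp (Suc k) y"
proof (induction k)
  case 0
  show ?case using assms by simp
next
  case (Suc k)
  have "0 \<le> y * dp (Suc k) y" using Suc assms by (intro mult_nonneg_nonneg) auto
  then have "dp (Suc k) y \<le> dp (Suc (Suc k)) y"
    using Suc by (simp add: dp_Suc_Suc algebra_simps del: dir_poly.simps)
  with Suc show ?case by linarith
qed

lemma dp_at_0: "dp k 0 = 1"
  by (induction k rule: dir_poly.induct) auto

text \<open>With n = k + 1 and y = - \<alpha> / p2 this is the denominator of
  \<open>kappa_star\<close>; its numerator is \<open>dp_diff_sum k y\<close> times the square root
  of p2.\<close>

definition dp_sum :: "nat \<Rightarrow> real \<Rightarrow> real" where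
  "dp_sum k y = (\<Sum>l = 0..k. real ((k + l) choose (2 * l)) * y ^ l)"

definition dp_diff_sum :: "nat \<Rightarrow> real \<Rightarrow> real" where
  "dp_diff_sum k y = (\<Sum>l = 0..k. real (Suc (k + l) choose (2 * l + 1)) * y ^ (l + 1))"

text \<open>Pascal's rule after shifting l by one; the extra top term that completes
  \<open>dp_sum k y\<close> has binomial coefficient 0.\<close>

lemma dp_sum_Suc: "dp_sum (Suc k) y = dp_sum k y + dp_diff_sum k y"
proof -
  have "dp_sum (Suc k) y =
      1 + (\<Sum>l = 0..k. real (Suc (Suc (k + l)) choose Suc (Suc (2 * l))) * y ^ Suc l)"
    unfolding dp_sum_def by (subst sum.atLeast0_atMost_Suc_shift) simp
  also have "\<dots> = 1 + (\<Sum>l = 0..k. real (Suc (k + l) choose Suc (Suc (2 * l))) * y ^ Suc l)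
      + dp_diff_sum k y"
    unfolding dp_diff_sum_def by (simp add: sum.distrib[symmetric] algebra_simps)
  also have "1 + (\<Sum>l = 0..k. real (Suc (k + l) choose Suc (Suc (2 * l))) * y ^ Suc l)
      = (\<Sum>l = 0..Suc k. real ((k + l) choose (2 * l)) * y ^ l)"
    by (subst sum.atLeast0_atMost_Suc_shift) simp
  also have "\<dots> = dp_sum k y"
    unfolding dp_sum_def by (simp add: binomial_eq_0 del: binomial_Suc_Suc)
  finally show ?thesis .
qed

lemma dp_diff_sum_Suc: "dp_diff_sum (Suc k) y = dp_diff_sum k y + y * dp_sum (Suc k) y"
proof -
  \<comment> \<open>The padding term l = k + 1 vanishes and aligns the ranges for Pascal's
    rule.\<close>
  have "dp_diff_sum k y = (\<Sum>l = 0..Suc k. real (Suc (k + l) choose (2 * l + 1)) * y ^ (l + 1))"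
    unfolding dp_diff_sum_def by (simp add: binomial_eq_0 del: binomial_Suc_Suc)
  then show ?thesis
    unfolding dp_diff_sum_def[of "Suc k"] dp_sum_def
    by (simp only: sum_distrib_left sum.distrib[symmetric])
      (intro sum.cong refl, simp add: algebra_simps)
qed

text \<open>Values and increments are treated together: the second-order recurrence is equivalent to
  the pair of first-order rules that the two sums obey.\<close>

lemma dp_closed_form:
  shows dp_eq_sum: "dp k y = dp_sum k y"
    and dp_diff_eq_sum: "dp (Suc k) y - dp k y = dp_diff_sum k y"
proof (induction k)
  case 0
  show "dp 0 y = dp_sum 0 y" "dp (Suc 0) y - dp 0 y = dp_diff_sum 0 y"
    by (simp_all add: dp_sum_def dp_diff_sum_def)
next
  case (Suc k)
  show *: "dp (Suc k) y = dp_sum (Suc k) y"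
    using Suc dp_sum_Suc[of k y] by linarith
  show "dp (Suc (Suc k)) y - dp (Suc k) y = dp_diff_sum (Suc k) y"
    using Suc dp_diff_sum_Suc[of k y] *
    by (simp add: dp_Suc_Suc algebra_simps del: dir_poly.simps)
qed

lemma dir_poly_ne_0: "dir_poly k \<noteq> 0"
  using dp_at_0[of k] by auto

text \<open>
  At the largest zero of dp (k+1) the recurrence gives dp (k+2) = - dp k, and dp k is nonnegative
  there, so dp (k+2) could not be positive.\<close>

lemma dp_pos_pred:
  assumes "\<And>t. s \<le> t \<Longrightarrow> 0 < dp (Suc k) t" and "s \<le> t"
  shows "0 < dp k t"
  using assms
proof (induction k arbitrary: s t)
  case 0
  show ?case by simp
next
  case (Suc k)
  show ?case
  proof (rule ccontr)
    assume neg: "\<not> 0 < dp (Suc k) t"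
    define Z where "Z = {u. dp (Suc k) u = 0 \<and> s \<le> u}"
    have fin: "finite Z"
      by (rule finite_subset[OF _ poly_roots_finite[OF dir_poly_ne_0[of "Suc k"]]])
        (auto simp: Z_def)
    \<comment> \<open>Values at nonnegative arguments are at least 1, so a nonpositive value forces
      a zero further right.\<close>
    have zero_right: "\<exists>v\<ge>u. dp (Suc k) v = 0" if "dp (Suc k) u \<le> 0" for u
    proof -
      have "dp (Suc k) u \<le> 0 \<and> 0 \<le> dp (Suc k) (max u 0)"
        using that dp_mono_ge_1[of "max u 0" "Suc k"] by simp
      then obtain v where "u \<le> v" "dp (Suc k) v = 0"
        using IVT'[of "dp (Suc k)" u 0 "max u 0"] by (auto simp: continuous_on_poly)
      then show ?thesis by auto
    qed
    obtain v where "t \<le> v" "dp (Suc k) v = 0"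
      using zero_right[of t] neg by (meson not_less)
    then have ne: "v \<in> Z" using Suc.prems(2) by (auto simp: Z_def)
    define m where "m = Max Z"
    have mZ: "m \<in> Z" using fin ne unfolding m_def by (intro Max_in) auto
    have pos: "0 < dp (Suc k) u" if "m < u" for u
    proof (rule ccontr)
      assume "\<not> 0 < dp (Suc k) u"
      then obtain v where "u \<le> v" "dp (Suc k) v = 0"
        using zero_right[of u] by (meson not_less)
      moreover from this that mZ have "v \<in> Z" by (auto simp: Z_def)
      ultimately show False using that Max_ge[OF fin, of v] by (simp add: m_def)
    qed
    \<comment> \<open>The induction hypothesis asks for positivity on a closed half-line, so it
      applies only strictly to the right of m; a right-hand limit then reaches m.\<close>
    have pos': "0 < dp k u" if "m < u" for u
      using Suc.IH[of u u] pos that by force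
    have "0 \<le> dp k m"
    proof (rule tendsto_lowerbound)
      show "(dp k \<longlongrightarrow> dp k m) (at_right m)"
        by (intro tendsto_intros)
      show "\<forall>\<^sub>F u in at_right m. 0 \<le> dp k u"
        using pos' by (auto simp: eventually_at_right_field intro!: exI[of _ "m + 1"] less_imp_le)
    qed simp
    moreover have "dp (Suc k) m = 0" "s \<le> m" using mZ by (auto simp: Z_def)
    ultimately show False using Suc.prems(1)[of m] by (simp add: dp_Suc_Suc del: dir_poly.simps)
  qed
qed

text \<open>Iterates \<open>dp_pos_pred\<close> downwards; each descent needs positivity on the
  whole half-line, not just at one point.\<close>

lemma dp_pos_le:
  assumes "j \<le> k" and "\<And>t. s \<le> t \<Longrightarrow> 0 < dp k t"
  shows "s \<le> t \<Longrightarrow> 0 < dp j t"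
  using assms
proof (induction j arbitrary: t rule: inc_induct)
  case (step j)
  then show ?case using dp_pos_pred by metis
qed

section \<open>Eigenvalues of general and of Metzler matrices\<close>

text \<open>A Gershgorin bound in the maximum norm weighted by w.\<close>

lemma metzler_eigenvalue_bound:
  fixes M :: "real mat" and w :: "nat \<Rightarrow> real"
  assumes M: "M \<in> carrier_mat n n" and metz: "metzler M"
    and w: "\<And>i. i < n \<Longrightarrow> 0 < w i"
    and Mw: "\<And>i. i < n \<Longrightarrow> (\<Sum>j<n. M $$ (i, j) * w j) \<le> x * w i"
    and ev: "eigenvalue (map_mat complex_of_real M) z"
  shows "Re z \<le> x"
proof -
  obtain v where v: "v \<in> carrier_vec n" "v \<noteq> 0\<^sub>v n"
    and Mv: "map_mat complex_of_real M *\<^sub>v v = z \<cdot>\<^sub>v v"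
    using ev M by (auto simp: eigenvalue_def eigenvector_def)
  obtain i0 where i0: "i0 < n" "v $ i0 \<noteq> 0"
    using v by force
  \<comment> \<open>The row i to be used maximises the weighted modulus of the eigenvector.\<close>
  define r where "r j = cmod (v $ j) / w j" for j
  define m where "m = Max (r ` {..<n})"
  have "m \<in> r ` {..<n}" unfolding m_def using i0 by (intro Max_in) auto
  then obtain i where i: "i < n" "m = r i" by auto
  have r_le: "r j \<le> m" if "j < n" for j unfolding m_def using that by auto
  have vw: "cmod (v $ j) \<le> m * w j" if "j < n" for j
    using r_le[OF that] w[OF that] by (simp add: r_def field_simps)
  have vi: "cmod (v $ i) = m * w i" using i w[of i] by (simp add: r_def)
  have "0 < r i0" using i0 w[of i0] by (simp add: r_def)
  then have mpos: "0 < m" using r_le[of i0] i0 by linarith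
  have wi: "0 < w i" using w i by simp
  have "i \<in> {..<n}" using i by simp
  note split = sum.remove[OF finite_lessThan this]
  have "(\<Sum>j<n. complex_of_real (M $$ (i, j)) * v $ j) = z * v $ i"
    using arg_cong[OF Mv, of "\<lambda>u. u $ i"] i M v
    by (simp add: scalar_prod_def lessThan_atLeast0)
  then have "(z - of_real (M $$ (i, i))) * v $ i
      = (\<Sum>j\<in>{..<n} - {i}. complex_of_real (M $$ (i, j)) * v $ j)"
    by (simp add: split algebra_simps)
  then have "cmod (z - of_real (M $$ (i, i))) * cmod (v $ i)
      = cmod (\<Sum>j\<in>{..<n} - {i}. complex_of_real (M $$ (i, j)) * v $ j)"
    by (metis norm_mult)
  also have "\<dots> \<le> (\<Sum>j\<in>{..<n} - {i}. M $$ (i, j) * (m * w j))"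
  proof (rule sum_norm_le)
    fix j assume j: "j \<in> {..<n} - {i}"
    then have "0 \<le> M $$ (i, j)" using metz M i by (auto simp: metzler_def)
    then show "cmod (complex_of_real (M $$ (i, j)) * v $ j) \<le> M $$ (i, j) * (m * w j)"
      using vw[of j] j by (auto simp: norm_mult intro: mult_left_mono)
  qed
  also have "\<dots> = m * (\<Sum>j\<in>{..<n} - {i}. M $$ (i, j) * w j)"
    by (simp add: sum_distrib_left mult_ac)
  also have "\<dots> \<le> m * ((x - M $$ (i, i)) * w i)"
    using Mw[of i] i mpos by (intro mult_left_mono) (auto simp: split algebra_simps)
  finally have "cmod (z - of_real (M $$ (i, i))) * (m * w i) \<le> (x - M $$ (i, i)) * (m * w i)"
    by (simp add: vi mult_ac)
  then have "cmod (z - of_real (M $$ (i, i))) \<le> x - M $$ (i, i)"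
    using mpos wi by simp
  \<comment> \<open>The disc around the diagonal entry has radius at most x minus that entry, so it
    does not extend beyond x on the right.\<close>
  moreover have "Re z - M $$ (i, i) \<le> cmod (z - of_real (M $$ (i, i)))"
    using complex_Re_le_cmod[of "z - of_real (M $$ (i, i))"] by simp
  ultimately show ?thesis by simp
qed

lemma finite_eigenvalues:
  fixes M :: "'a :: field mat"
  assumes "M \<in> carrier_mat n n"
  shows "finite {x. eigenvalue M x}"
proof -
  have "char_poly M \<noteq> 0" using degree_monic_char_poly[OF assms] by auto
  then show ?thesis
    using poly_roots_finite by (simp add: eigenvalue_root_char_poly[OF assms])
qed

section \<open>Rows of the matrices applied to the recurrence vector\<close>

lemma A_mat_carrier: "A_mat D L n \<in> carrier_mat n n"
  by (simp add: A_mat_def)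

lemma A_kappa_carrier: "A_kappa D L n \<kappa> \<in> carrier_mat n n"
  using A_mat_carrier[of D L n] by (auto simp: A_kappa_def mat_of_row_def)

lemma A_kappa_index:
  assumes "i < n" "j < n"
  shows "A_kappa D L n \<kappa> $$ (i, j) =
    A_mat D L n $$ (i, j) + (if i = 0 \<and> j = 0 then \<kappa> * p1 D L n else 0)"
  using assms A_mat_carrier[of D L n]
  by (auto simp: A_kappa_def mat_of_row_def mat_of_cols_def scalar_prod_def)

lemma A_mat_row:
  assumes "2 \<le> n" "i < n"
  shows "(\<Sum>j<n. A_mat D L n $$ (i, j) * w j) =
    p2 D L n * ((if i = 0 then 0 else w (i - 1) - w i) + (if i = n - 1 then 0 else w (i + 1) - w i))"
proof -
  let ?q = "p2 D L n"
  \<comment> \<open>The entries are split by diagonal. For i = 0 the guard in the last summand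
    matters: truncated subtraction makes i - 1 = 0, the diagonal position.\<close>
  have "(\<Sum>j<n. A_mat D L n $$ (i, j) * w j) =
      (\<Sum>j<n. (if j = i then (if i = 0 \<or> i = n - 1 then - ?q else - 2 * ?q) * w j else 0)
        + (if j = i + 1 then ?q * w j else 0)
        + (if j = i - 1 then (if i = 0 then 0 else ?q * w j) else 0))"
    using assms by (intro sum.cong refl) (auto simp: A_mat_def)
  also have "\<dots> = (if i = 0 \<or> i = n - 1 then - ?q else - 2 * ?q) * w i
      + (if i + 1 < n then ?q * w (i + 1) else 0) + (if i = 0 then 0 else ?q * w (i - 1))"
    using assms by (simp add: sum.distrib)
  also have "\<dots> = ?q * ((if i = 0 then 0 else w (i - 1) - w i)
      + (if i = n - 1 then 0 else w (i + 1) - w i))"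
    using assms by (auto simp: algebra_simps)
  finally show ?thesis .
qed

text \<open>The last row is the start of the recurrence and inner rows are the recurrence itself.
  The first row lacks the neighbour \<open>dp n t\<close>, which leaves a defect.\<close>

lemma A_mat_row_dp:
  assumes "2 \<le> n" "i < n"
  shows "(\<Sum>j<n. A_mat D L n $$ (i, j) * dp (n - 1 - j) t) = p2 D L n * (t * dp (n - 1 - i) t -
      (if i = 0 then dp n t - dp (n - 1) t else 0))"
proof (cases "i = n - 1")
  case True
  then show ?thesis using assms by (subst A_mat_row) (auto simp: Suc_diff_Suc numeral_2_eq_2)
next
  case False
  \<comment> \<open>The row and its neighbours then carry the indices k, k + 1, k + 2, free of
    truncation.\<close>
  define k where "k = n - 2 - i"
  have k: "n - 1 - i = Suc k" "n - 1 - (i + 1) = k" "i \<noteq> 0 \<Longrightarrow> n - 1 - (i - 1) = Suc (Suc k)"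
    "i = 0 \<Longrightarrow> n = Suc (Suc k)"
    using assms False by (auto simp: k_def)
  show ?thesis
    using False k by (subst A_mat_row[OF assms]) (auto simp: dp_Suc_Suc algebra_simps simp del: dir_poly.simps)
qed

lemma A_kappa_row_dp:
  assumes "2 \<le> n" "i < n"
  shows "(\<Sum>j<n. A_kappa D L n \<kappa> $$ (i, j) * dp (n - 1 - j) t) = p2 D L n * t * dp (n - 1 - i) t -
      (if i = 0 then p2 D L n * (dp n t - dp (n - 1) t) - \<kappa> * p1 D L n * dp (n - 1) t else 0)"
proof -
  have "(\<Sum>j<n. A_kappa D L n \<kappa> $$ (i, j) * dp (n - 1 - j) t) =
      (\<Sum>j<n. A_mat D L n $$ (i, j) * dp (n - 1 - j) t
        + (if j = 0 then (if i = 0 then \<kappa> * p1 D L n * dp (n - 1) t else 0) else 0))"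
    using assms by (intro sum.cong refl) (auto simp: A_kappa_index algebra_simps)
  also have "\<dots> = (\<Sum>j<n. A_mat D L n $$ (i, j) * dp (n - 1 - j) t)
      + (if i = 0 then \<kappa> * p1 D L n * dp (n - 1) t else 0)"
    using assms by (simp add: sum.distrib)
  finally show ?thesis
    unfolding A_mat_row_dp[OF assms] by (auto simp: algebra_simps)
qed

section \<open>The trailing minor and explicit eigenvectors\<close>

lemma pick_atLeastLessThan:
  assumes "a + i < b"
  shows "pick {a..<b} i = a + i"
proof -
  have "{x \<in> {a..<b}. x < a + i} = {a..<a + i}" using assms by auto
  then show ?thesis using pick_card_in_set[of "a + i" "{a..<b}"] assms by simp
qed

lemma submatrix_atLeastLessThan_1:
  assumes "M \<in> carrier_mat n n"
  shows "submatrix M {1..<n} {1..<n} = mat (n - 1) (n - 1) (\<lambda>(i, j). M $$ (i + 1, j + 1))"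
proof -
  have "dim_row M = n" "dim_col M = n" "{i. i < n \<and> i \<in> {1..<n}} = {1..<n}"
    using assms by auto
  then show ?thesis
    unfolding submatrix_def by (intro eq_matI) (simp_all add: pick_atLeastLessThan)
qed

definition tail_mat :: "real \<Rightarrow> real \<Rightarrow> nat \<Rightarrow> real mat" where
  "tail_mat D L n = submatrix (A_mat D L n) {1..<n} {1..<n}"

lemma tail_mat_carrier: "tail_mat D L n \<in> carrier_mat (n - 1) (n - 1)"
  unfolding tail_mat_def submatrix_atLeastLessThan_1[OF A_mat_carrier] by simp

text \<open>Deleting the first row and column commutes with subtracting x times the identity. So
  \<open>alpha_f\<close> is a maximum over a spectrum.\<close>

lemma trailing_minor_eq_0_iff:
  assumes "2 \<le> n"
  shows "trailing_minor (A_mat D L n - x \<cdot>\<^sub>m 1\<^sub>m n) (n - 1) = 0 \<longleftrightarrow> eigenvalue (tail_mat D L n) x"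
proof -
  let ?A = "A_mat D L n"
  have A: "?A \<in> carrier_mat n n" "?A - x \<cdot>\<^sub>m 1\<^sub>m n \<in> carrier_mat n n"
    using A_mat_carrier by auto
  have "n - (n - 1) = 1" using assms by simp
  then have "trailing_minor (?A - x \<cdot>\<^sub>m 1\<^sub>m n) (n - 1)
      = det (submatrix (?A - x \<cdot>\<^sub>m 1\<^sub>m n) {1..<n} {1..<n})"
    using A by (simp add: trailing_minor_def)
  also have "submatrix (?A - x \<cdot>\<^sub>m 1\<^sub>m n) {1..<n} {1..<n} = char_matrix (tail_mat D L n) x"
    unfolding tail_mat_def submatrix_atLeastLessThan_1[OF A(1)] submatrix_atLeastLessThan_1[OF A(2)]
    using A(1) by (auto simp: char_matrix_def intro!: eq_matI)
  finally show ?thesis using eigenvalue_det[OF tail_mat_carrier] by simp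
qed

lemma eigenvalue_tail_mat:
  assumes n: "2 \<le> n" and root: "dp (n - 1) t = 0"
  shows "eigenvalue (tail_mat D L n) (p2 D L n * t)"
proof -
  obtain m where m: "n = Suc m" using n by (cases n) auto
  have B: "tail_mat D L n = mat m m (\<lambda>(i, j). A_mat D L n $$ (i + 1, j + 1))"
    by (simp only: tail_mat_def submatrix_atLeastLessThan_1[OF A_mat_carrier]) (simp add: m)
  define v where "v = vec m (\<lambda>j. dp (m - 1 - j) t)"
  have "v $ (m - 1) = 1" "m - 1 < m" using n m by (auto simp: v_def)
  then have "v \<noteq> 0\<^sub>v m" by auto
  moreover have "tail_mat D L n *\<^sub>v v = (p2 D L n * t) \<cdot>\<^sub>v v"
  proof (rule eq_vecI)
    fix i assume "i < dim_vec ((p2 D L n * t) \<cdot>\<^sub>v v)"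
    then have i: "i < m" by (simp add: v_def)
    have "(tail_mat D L n *\<^sub>v v) $ i = (\<Sum>j<m. A_mat D L n $$ (i + 1, Suc j) * dp (m - Suc j) t)"
      using i by (simp add: B v_def scalar_prod_def lessThan_atLeast0)
    \<comment> \<open>The deleted column 0 would be weighted by \<open>dp (n - 1) t\<close>, which
      is 0.\<close>
    also have "\<dots> = (\<Sum>j<n. A_mat D L n $$ (i + 1, j) * dp (n - 1 - j) t)"
      using root unfolding m by (subst sum.lessThan_Suc_shift) simp
    also have "\<dots> = ((p2 D L n * t) \<cdot>\<^sub>v v) $ i"
      using i n m by (subst A_mat_row_dp) (auto simp: v_def)
    finally show "(tail_mat D L n *\<^sub>v v) $ i = ((p2 D L n * t) \<cdot>\<^sub>v v) $ i" .
  qed (simp add: B v_def)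
  ultimately show ?thesis
    unfolding eigenvalue_def eigenvector_def by (intro exI[of _ v]) (simp add: B v_def)
qed

text \<open>The assumption \<open>root\<close> says that the boundary term in \<kappa> cancels the
  defect of the first row.\<close>

lemma eigenvalue_A_kappa:
  assumes n: "2 \<le> n"
    and root: "p2 D L n * (dp n t - dp (n - 1) t) = \<kappa> * p1 D L n * dp (n - 1) t"
  shows "eigenvalue (A_kappa D L n \<kappa>) (p2 D L n * t)"
proof -
  define v where "v = vec n (\<lambda>j. dp (n - 1 - j) t)"
  have "v $ (n - 1) = 1" "n - 1 < n" using n by (auto simp: v_def)
  then have "v \<noteq> 0\<^sub>v n" by auto
  moreover have "A_kappa D L n \<kappa> *\<^sub>v v = (p2 D L n * t) \<cdot>\<^sub>v v"
  proof (rule eq_vecI)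
    fix i assume "i < dim_vec ((p2 D L n * t) \<cdot>\<^sub>v v)"
    then have i: "i < n" by (simp add: v_def)
    have "(A_kappa D L n \<kappa> *\<^sub>v v) $ i = (\<Sum>j<n. A_kappa D L n \<kappa> $$ (i, j) * dp (n - 1 - j) t)"
      using i A_kappa_carrier[of D L n \<kappa>] by (simp add: v_def scalar_prod_def lessThan_atLeast0)
    also have "\<dots> = ((p2 D L n * t) \<cdot>\<^sub>v v) $ i"
      using i root by (subst A_kappa_row_dp[OF n]) (auto simp: v_def)
    finally show "(A_kappa D L n \<kappa> *\<^sub>v v) $ i = ((p2 D L n * t) \<cdot>\<^sub>v v) $ i" .
  qed (use A_kappa_carrier[of D L n \<kappa>] in \<open>simp add: v_def\<close>)
  ultimately show ?thesis
    using A_kappa_carrier[of D L n \<kappa>]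
    unfolding eigenvalue_def eigenvector_def by (intro exI[of _ v]) (simp add: v_def)
qed

text \<open>A nonpositive value would give a zero u \<ge> t, hence an eigenvalue p2 * u \<ge> x of
  \<open>tail_mat\<close>, above its maximum \<open>alpha_f\<close>.\<close>

lemma dp_pos_of_alpha_f:
  assumes n: "2 \<le> n" and q: "0 < p2 D L n" and x: "alpha_f D L n < x" and t: "x / p2 D L n \<le> t"
  shows "0 < dp (n - 1) t"
proof (rule ccontr)
  assume neg: "\<not> 0 < dp (n - 1) t"
  have "0 \<le> dp (n - 1) (max t 0)"
    using dp_mono_ge_1[of "max t 0" "n - 1"] by simp
  then obtain u where u: "t \<le> u" "dp (n - 1) u = 0"
    using IVT'[of "dp (n - 1)" t 0 "max t 0"] neg by (auto simp: continuous_on_poly not_less)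
  from finite_eigenvalues[OF tail_mat_carrier] eigenvalue_tail_mat[OF n u(2)]
  have "p2 D L n * u \<le> alpha_f D L n"
    unfolding alpha_f_def trailing_minor_eq_0_iff[OF n] by (intro Max_ge) auto
  moreover have "x \<le> p2 D L n * u"
    using order_trans[OF t u(1)] q by (simp add: pos_divide_le_eq mult.commute)
  ultimately show False using x by simp
qed

text \<open>The parameter \<kappa> enters only a diagonal entry.\<close>

lemma metzler_A_kappa:
  assumes "0 < p2 D L n"
  shows "metzler (A_kappa D L n \<kappa>)"
  using assms A_kappa_carrier[of D L n \<kappa>]
  by (auto simp: metzler_def A_kappa_index A_mat_def)

section \<open>The closed form and the feasible set\<close>

text \<open>Identifies \<open>kappa_star\<close> as the solution of the first-row equation at y. If
  \<open>dp (n - 1) y\<close> is 0, both sides are 0 by division by zero.\<close>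

lemma kappa_star_mult_p1:
  fixes D L \<alpha> :: real
  assumes n: "2 \<le> n" and D: "0 < D" and L: "0 < L"
  defines "y \<equiv> - \<alpha> / p2 D L n"
  shows "kappa_star D L n \<alpha> * p1 D L n = p2 D L n * ((dp n y - dp (n - 1) y) / dp (n - 1) y)"
proof -
  let ?q = "p2 D L n"
  obtain k where k: "n = Suc k" using n by (cases n) auto
  have h: "0 < dz L n" using n L by (simp add: dz_def)
  have q: "0 < ?q" using h D by (simp add: p2_def)
  have sq: "sqrt ?q = sqrt D / dz L n"
    using h by (simp add: p2_def real_sqrt_mult real_sqrt_inverse divide_inverse)
  have "(\<Sum>l = 0..n - 1. real ((n + l) choose (2 * l + 1)) *
      ((- \<alpha>) ^ (l + 1) / ?q powr (real l + 1 / 2))) = sqrt ?q * dp_diff_sum k y"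
    unfolding dp_diff_sum_def sum_distrib_left
  proof (intro sum.cong)
    fix l
    \<comment> \<open>Writing the half-integer power as a full power over a square root lets that
      root leave the sum.\<close>
    have "?q powr (real l + 1 / 2) = ?q ^ l * sqrt ?q"
      using q by (simp add: powr_add powr_realpow powr_half_sqrt)
    also have "\<dots> = ?q ^ l * (?q / sqrt ?q)"
      by (simp only: real_div_sqrt[OF less_imp_le[OF q]])
    also have "\<dots> = ?q ^ (l + 1) / sqrt ?q"
      by simp
    finally have "(- \<alpha>) ^ (l + 1) / ?q powr (real l + 1 / 2) = sqrt ?q * y ^ (l + 1)"
      by (simp only: y_def power_divide) simp
    then show "real ((n + l) choose (2 * l + 1)) * ((- \<alpha>) ^ (l + 1) / ?q powr (real l + 1 / 2))
        = sqrt ?q * (real (Suc (k + l) choose (2 * l + 1)) * y ^ (l + 1))"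
      by (simp only: k) (simp add: mult_ac)
  qed (simp add: k)
  moreover have "(\<Sum>l = 0..n - 1. real ((n + l - 1) choose (2 * l)) * ((- \<alpha>) ^ l / ?q ^ l)) = dp_sum k y"
    by (simp only: dp_sum_def y_def power_divide) (simp add: k)
  ultimately have "kappa_star D L n \<alpha> = 1 / sqrt D * (sqrt ?q * dp_diff_sum k y / dp_sum k y)"
    unfolding kappa_star_def by (simp only:)
  \<comment> \<open>The factor \<open>sqrt D\<close> cancels, leaving 1 / \<open>dz L n\<close>,
    which is p2 / p1.\<close>
  also have "\<dots> = (dp n y - dp (n - 1) y) / dp (n - 1) y / dz L n"
    unfolding sq using D by (simp add: k mult.commute del: dir_poly.simps flip: dp_diff_eq_sum dp_eq_sum)
  finally show ?thesis using h by (simp add: p1_def p2_def field_simps power2_eq_square)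
qed

lemma feasible_imp_root_le:
  assumes n: "2 \<le> n" and \<alpha>: "- \<alpha> < 0"
    and feas: "feasible D L n \<alpha> \<kappa>"
    and root: "p2 D L n * (dp n t - dp (n - 1) t) = \<kappa> * p1 D L n * dp (n - 1) t"
  shows "p2 D L n * t \<le> - \<alpha>"
proof (rule ccontr)
  assume "\<not> p2 D L n * t \<le> - \<alpha>"
  \<comment> \<open>This rate lies in the admissible range, as 0 and p2 * t both exceed - \<alpha>,
    yet it does not exceed the eigenvalue p2 * t.\<close>
  then have "exp_stable (min 0 (p2 D L n * t)) (A_kappa D L n \<kappa>)"
    using feas \<alpha> by (simp add: feasible_def)
  moreover have "eigenvalue (map_mat complex_of_real (A_kappa D L n \<kappa>)) (of_real (p2 D L n * t))"
    using eigenvalue_A_kappa[OF n root] A_kappa_carrier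
    by (intro of_real_hom.eigenvalue_hom) auto
  ultimately show False by (force simp: exp_stable_def)
qed

lemma feasible_iff:
  assumes n: "2 \<le> n" and D: "0 < D" and L: "0 < L"
    and \<alpha>: "alpha_f D L n < - \<alpha>" "- \<alpha> < 0"
  shows "feasible D L n \<alpha> \<kappa> \<longleftrightarrow> \<kappa> \<le> kappa_star D L n \<alpha>"
proof -
  define q where "q = p2 D L n"
  define y where "y = - \<alpha> / q"
  have h: "0 < dz L n" using n L by (simp add: dz_def)
  have q: "0 < q" using h D by (simp add: q_def p2_def)
  have p: "0 < p1 D L n" using h D by (simp add: p1_def)
  have pos: "0 < dp (n - 1) t" if "y \<le> t" for t
    using dp_pos_of_alpha_f[OF n _ \<alpha>(1)] q that by (simp add: q_def y_def)
  \<comment> \<open>In this scaling the first-row equation reads dp n - dp (n - 1) = c * dp (n -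
    1).\<close>
  define c where "c = \<kappa> * p1 D L n / q"
  have "\<kappa> \<le> kappa_star D L n \<alpha> \<longleftrightarrow> \<kappa> * p1 D L n \<le> kappa_star D L n \<alpha> * p1 D L n"
    using p by simp
  also have "\<dots> \<longleftrightarrow> c \<le> (dp n y - dp (n - 1) y) / dp (n - 1) y"
    unfolding kappa_star_mult_p1[OF n D L] c_def using q
    by (simp add: q_def y_def field_simps)
  also have "\<dots> \<longleftrightarrow> c * dp (n - 1) y \<le> dp n y - dp (n - 1) y"
    using pos[of y] by (simp add: field_simps)
  finally have le_iff: "\<kappa> \<le> kappa_star D L n \<alpha> \<longleftrightarrow> c * dp (n - 1) y \<le> dp n y - dp (n - 1) y" .
  have qc: "\<kappa> * p1 D L n = q * c" using q by (simp add: c_def)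
  have qy: "q * y = - \<alpha>" using q by (simp add: y_def)
  show ?thesis
  proof
    assume le: "\<kappa> \<le> kappa_star D L n \<alpha>"
    have "Re z \<le> - \<alpha>" if "eigenvalue (map_mat complex_of_real (A_kappa D L n \<kappa>)) z" for z
    proof (rule metzler_eigenvalue_bound[OF A_kappa_carrier metzler_A_kappa _ _ that])
      show "0 < p2 D L n" using q q_def by simp
      fix i assume i: "i < n"
      show "0 < dp (n - 1 - i) y"
        by (rule dp_pos_le[of _ "n - 1" y]) (use pos in auto)
      have "q * (c * dp (n - 1) y) \<le> q * (dp n y - dp (n - 1) y)"
        using le q unfolding le_iff by (intro mult_left_mono) auto
      then show "(\<Sum>j<n. A_kappa D L n \<kappa> $$ (i, j) * dp (n - 1 - j) y) \<le> - \<alpha> * dp (n - 1 - i) y"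
        unfolding A_kappa_row_dp[OF n i] q_def[symmetric] qc qy by (simp add: mult_ac)
    qed
    then show "feasible D L n \<alpha> \<kappa>"
      using metzler_A_kappa[of D L n \<kappa>] q by (force simp: feasible_def exp_stable_def q_def)
  next
    assume feas: "feasible D L n \<alpha> \<kappa>"
    show "\<kappa> \<le> kappa_star D L n \<alpha>"
    proof (rule ccontr)
      assume "\<not> \<kappa> \<le> kappa_star D L n \<alpha>"
      then have neg: "dp n y - dp (n - 1) y - c * dp (n - 1) y < 0" unfolding le_iff by simp
      obtain k where k: "n = Suc (Suc k)"
        using n by (metis Suc_le_D numeral_2_eq_2 Suc_le_mono)
      \<comment> \<open>At T \<ge> c and T \<ge> 0 the recurrence splits the first-row difference
        into two nonnegative terms; T \<ge> y keeps the interval nonempty.\<close>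
      define T where "T = max 0 (max c y)"
      have "0 \<le> (T - c) * dp (Suc k) T + (dp (Suc k) T - dp k T)"
        using dp_mono_ge_1[of T k] by (intro add_nonneg_nonneg mult_nonneg_nonneg) (auto simp: T_def)
      then have "0 \<le> dp n T - dp (n - 1) T - c * dp (n - 1) T"
        unfolding k by (simp add: dp_Suc_Suc algebra_simps del: dir_poly.simps)
      then have "\<exists>t\<ge>y. t \<le> T \<and> dp n t - dp (n - 1) t - c * dp (n - 1) t = 0"
        using neg by (intro IVT') (auto simp: T_def le_max_iff_disj intro!: continuous_intros)
      then obtain t where t: "y \<le> t" "dp n t - dp (n - 1) t - c * dp (n - 1) t = 0"
        by blast
      \<comment> \<open>Strict negativity at y makes the eigenvalue q * t exceed - \<alpha>
        strictly.\<close>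
      with neg have "y < t" by (cases "y = t") auto
      then have "- \<alpha> < q * t" using q qy by (metis mult_strict_left_mono)
      moreover have "p2 D L n * (dp n t - dp (n - 1) t) = \<kappa> * p1 D L n * dp (n - 1) t"
        using t(2) unfolding qc q_def[symmetric] by simp
      ultimately show False
        using feasible_imp_root_le[OF n \<alpha>(2) feas, of t] by (simp add: q_def)
    qed
  qed
qed

theorem theorem5:
  fixes n :: nat and D L \<alpha> :: real
  assumes "2 \<le> n" and "0 < D" and "0 < L"
    and "alpha_f D L n < - \<alpha>" and "- \<alpha> < 0"
  shows "(\<exists>!\<kappa>. is_solution D L n \<alpha> \<kappa>) \<and> is_solution D L n \<alpha> (kappa_star D L n \<alpha>)"
proof -
  let ?k = "kappa_star D L n \<alpha>"
  note feas = feasible_iff[OF assms]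
  \<comment> \<open>All dp are 1 at 0, so t = 0 solves the first-row equation for \<kappa> = 0, and
    feasibility would force 0 \<le> - \<alpha>.\<close>
  have "\<not> feasible D L n \<alpha> 0"
    using feasible_imp_root_le[OF assms(1,5), of D L 0 0] assms(5) by (auto simp: dp_at_0)
  then have neg: "?k < 0" using feas by simp
  \<comment> \<open>The feasible half-line lies left of 0, where squaring is strictly
    decreasing.\<close>
  have less: "?k\<^sup>2 < \<kappa>\<^sup>2" if "\<kappa> < ?k" for \<kappa>
    using neg that power_strict_mono[of "- ?k" "- \<kappa>" 2] by simp
  have "is_solution D L n \<alpha> ?k"
    using less by (fastforce simp: is_solution_def is_arg_min_def feas le_less)
  moreover have "\<kappa> = ?k" if "is_solution D L n \<alpha> \<kappa>" for \<kappa>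
    using that less[of \<kappa>] by (auto simp: is_solution_def is_arg_min_def feas le_less)
  ultimately show ?thesis by blast
qed

end
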